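(* Let $n\ge1$, $0<\alpha<2$, and let $G\in C^1(\mathbb{R})$ satisfy $G(0)=0$ and $G'(t)\ge c_0>0$ for all $t\in\mathbb{R}$. Let $\mathbb{R}^n_+=\{x=(x_1,\dots,x_n): x_n>0\}$. Assume that $u\in L_\alpha\cap C^{1,1}_{loc}(\mathbb{R}^n)$ is a nonnegative solution of $$\begin{cases}F_\alpha(u(x))=h(u(x)), & x\in\mathbb{R}^n_+,\\ u(x)\equiv0, & x\notin\mathbb{R}^n_+.\end{cases}$$ Suppose that $\lim_{|x|\to\infty}u(x)=0$, that $h(s)$ is Lipschitz continuous in the range of $u$, and that $h(0)=0$. Then $u\equiv0$.
   Context: For $0<\alpha<2$, $$F_\alpha(u(x)) = C_{n,\alpha}\lim_{\epsilon\to0}\int_{\mathbb{R}^n\setminus B_\epsilon(x)}\frac{G(u(x)-u(z))}{|x-z|^{n+\alpha}}\,dz,$$ where $C_{n,\alpha}>0$ is a constant depending only on $n$ and $\alpha$; the equation presupposes that this limit exists and is finite at each $x\in\mathbb{R}^n_+$. The space $L_\alpha$ is $$L_\alpha=\Big\{u\in L^1_{loc}(\mathbb{R}^n)\ :\ \int_{\mathbb{R}^n}\frac{|u(x)|}{1+|x|^{n+\alpha}}\,dx<\infty\Big\}.$$ *)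

theory Defs
  imports "HOL-Analysis.Analysis"
begin

(* The index type is unordered; an arbitrary coordinate k plays the role of the last one. *)
definition half_space :: "'n::finite \<Rightarrow> (real ^ 'n) set" where
  "half_space k = {x. 0 < x $ k}"

definition C11_loc :: "(real ^ 'n::finite \<Rightarrow> real) \<Rightarrow> bool" where
  "C11_loc u \<longleftrightarrow>
     (\<exists>Du. (\<forall>x. GDERIV u x :> Du x) \<and> (\<forall>K. compact K \<longrightarrow> (\<exists>L. L-lipschitz_on K Du)))"

definition L1_loc :: "(real ^ 'n::finite \<Rightarrow> real) \<Rightarrow> bool" where
  "L1_loc u \<longleftrightarrow> (\<forall>K. compact K \<longrightarrow> set_integrable lebesgue K u)"

definition L_space :: "real \<Rightarrow> (real ^ 'n::finite \<Rightarrow> real) set" where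
  "L_space \<alpha> =
     {u. L1_loc u \<and>
         integrable lebesgue (\<lambda>x. \<bar>u x\<bar> / (1 + norm x powr (real CARD('n) + \<alpha>)))}"

definition F_integrand ::
  "real \<Rightarrow> (real \<Rightarrow> real) \<Rightarrow> (real ^ 'n::finite \<Rightarrow> real) \<Rightarrow> real ^ 'n \<Rightarrow> real ^ 'n \<Rightarrow> real" where
  "F_integrand \<alpha> G u x z = G (u x - u z) / norm (x - z) powr (real CARD('n) + \<alpha>)"

definition F_truncated ::
  "real \<Rightarrow> (real \<Rightarrow> real) \<Rightarrow> (real ^ 'n::finite \<Rightarrow> real) \<Rightarrow> real ^ 'n \<Rightarrow> real \<Rightarrow> real" where
  "F_truncated \<alpha> G u x \<epsilon> = (LINT z:(- ball x \<epsilon>)|lebesgue. F_integrand \<alpha> G u x z)"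

(* Bochner integrals and Lim are total, so the existence of the truncated integrals
   and of their finite limit is recorded separately. *)
definition F_defined ::
  "real \<Rightarrow> (real \<Rightarrow> real) \<Rightarrow> (real ^ 'n::finite \<Rightarrow> real) \<Rightarrow> real ^ 'n \<Rightarrow> bool" where
  "F_defined \<alpha> G u x \<longleftrightarrow>
     (\<forall>\<epsilon>>0. set_integrable lebesgue (- ball x \<epsilon>) (F_integrand \<alpha> G u x)) \<and>
     (\<exists>l. (F_truncated \<alpha> G u x \<longlongrightarrow> l) (at_right 0))"

(* C stands for the normalising constant depending on the dimension and \<alpha>. *)
definition F_op ::
  "real \<Rightarrow> real \<Rightarrow> (real \<Rightarrow> real) \<Rightarrow> (real ^ 'n::finite \<Rightarrow> real) \<Rightarrow> real ^ 'n \<Rightarrow> real" where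
  "F_op C \<alpha> G u x = C * Lim (at_right 0) (F_truncated \<alpha> G u x)"

end

(* Since u is nonnegative and C^{1,1} across the boundary, u and Du vanish at the boundary point 0.
   Let x = t e_k with t -> 0+.  The equation gives F_alpha(u)(x) = h(u(x)) -> 0.  The part of the
   integral far from x has limit at most -delta < 0 unless u vanishes identically, because
   G(-u(z)) < 0 wherever u(z) > 0.  It remains to bound the part |x - z| < r.
   Replacing u(x) - u(x + y) by -Du(x).y costs O(r^(2 - alpha)).  As G is only C^1, the remaining
   term A(p, e, r), the integral of G(-p.y) |y|^(-n-alpha) over e <= |y| < r with p = Du(x), need not
   converge absolutely.  But the equation presupposes that the limit exists at some point x1 with
   Du(x1) = q nonzero, so A(q, e, r) is bounded; and by scaling and rotation
   A(p, e, r) = l^alpha A(q, l e, l r) with l = |p| / |q|, which tends to 0 since Du(x) -> Du(0) = 0. *)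
theory Submission
  imports Defs
begin

section \<open>Lebesgue measure under similarities\<close>

lemma borel_measurable_orthogonal_transformation:
  fixes T :: "'a::euclidean_space \<Rightarrow> 'a"
  assumes "orthogonal_transformation T"
  shows "T \<in> borel_measurable borel"
  using orthogonal_transformation_linear[OF assms]
  by (intro borel_measurable_continuous_onI linear_continuous_on) (simp add: linear_linear)

lemma nn_integral_lborel_translate:
  fixes f :: "'a::euclidean_space \<Rightarrow> ennreal"
  assumes [measurable]: "f \<in> borel_measurable borel"
  shows "(\<integral>\<^sup>+ y. f (c + y) \<partial>lborel) = (\<integral>\<^sup>+ y. f y \<partial>lborel)"
proof -
  have "(\<integral>\<^sup>+ y. f y \<partial>lborel) = (\<integral>\<^sup>+ y. f y \<partial>distr lborel borel ((+) c))"
    by (simp add: lborel_distr_plus)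
  also have "\<dots> = (\<integral>\<^sup>+ y. f (c + y) \<partial>lborel)"
    by (subst nn_integral_distr) auto
  finally show ?thesis by simp
qed

text \<open>The image measure is translation invariant, and Fubini shows that two translation invariant
  measures are proportional; the unit ball fixes the factor. (The change of variables theorems of
  the library need a well-ordered index type.)\<close>
lemma lborel_distr_orthogonal_transformation:
  fixes T :: "'a::euclidean_space \<Rightarrow> 'a"
  assumes T: "orthogonal_transformation T"
  shows "distr lborel borel T = lborel"
proof (rule measure_eqI)
  note [measurable] = borel_measurable_orthogonal_transformation[OF T]
  interpret P: pair_sigma_finite "lborel :: 'a measure" "lborel :: 'a measure" ..
  fix A :: "'a set"
  assume "A \<in> sets (distr lborel borel T)"
  hence [measurable]: "A \<in> sets borel" by simp
  define B :: "'a set" where "B = ball 0 1"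
  have [measurable]: "B \<in> sets borel" by (simp add: B_def)
  have TB: "T x \<in> B \<longleftrightarrow> x \<in> B" for x
    by (simp add: B_def orthogonal_transformation_norm[OF T])
  have lin: "T (a + b) = T a + T b" "T (- a) = - T a" for a b
    using orthogonal_transformation_linear[OF T] by (simp_all add: linear_add linear_neg)
  have "emeasure (distr lborel borel T) A * emeasure lborel B
      = (\<integral>\<^sup>+ x. indicator A (T x) * emeasure lborel B \<partial>lborel)"
  proof -
    have "emeasure (distr lborel borel T) A = (\<integral>\<^sup>+ x. indicator A x \<partial>distr lborel borel T)"
      by simp
    also have "\<dots> = (\<integral>\<^sup>+ x. indicator A (T x) \<partial>lborel)"
      by (rule nn_integral_distr) measurable
    finally show ?thesis by (simp add: nn_integral_multc)
  qed
  \<comment> \<open>The mass of \<open>B\<close> is written as an integral over all shifts, based at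
    the moving point \<open>T x\<close>. This couples \<open>A\<close> with \<open>B\<close>, so
    that exchanging the integrals can trade one for the other.\<close>
  also have "\<dots> = (\<integral>\<^sup>+ x. \<integral>\<^sup>+ y. indicator A (T x) * indicator B (T x + y) \<partial>lborel \<partial>lborel)"
    by (simp add: nn_integral_cmult nn_integral_lborel_translate[of "indicator B"])
  also have "\<dots> = (\<integral>\<^sup>+ y. \<integral>\<^sup>+ x. indicator A (T x) * indicator B (T x + y) \<partial>lborel \<partial>lborel)"
    by (rule lborel_pair.Fubini') measurable
  also have "\<dots> = (\<integral>\<^sup>+ y. \<integral>\<^sup>+ x. indicator A (T x - y) * indicator B (T x) \<partial>lborel \<partial>lborel)"
  proof (rule nn_integral_cong)
    fix y :: 'a
    \<comment> \<open>Surjectivity lets a translation of \<open>x\<close> by \<open>w\<close> move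
      the shift from \<open>B\<close> to \<open>A\<close>; this is the translation invariance of the
      image measure.\<close>
    obtain w where w: "T w = - y"
      using orthogonal_transformation_surj[OF T] by (metis surjD)
    have "(\<integral>\<^sup>+ x. indicator A (T x) * indicator B (T x + y) \<partial>lborel)
        = (\<integral>\<^sup>+ x. (indicator A (T (w + x)) * indicator B (T (w + x) + y) :: ennreal) \<partial>lborel)"
      by (rule nn_integral_lborel_translate[symmetric]) measurable
    thus "(\<integral>\<^sup>+ x. indicator A (T x) * indicator B (T x + y) \<partial>lborel)
        = (\<integral>\<^sup>+ x. (indicator A (T x - y) * indicator B (T x) :: ennreal) \<partial>lborel)"
      by (simp add: lin w)
  qed
  also have "\<dots> = (\<integral>\<^sup>+ x. \<integral>\<^sup>+ y. indicator B (T x) * indicator A (T x - y) \<partial>lborel \<partial>lborel)"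
    by (subst lborel_pair.Fubini') (auto simp: mult.commute)
  also have "\<dots> = (\<integral>\<^sup>+ x. indicator B x * emeasure lborel A \<partial>lborel)"
  proof (rule nn_integral_cong)
    fix x :: 'a
    have "(\<integral>\<^sup>+ y. indicator A (T x - y) \<partial>lborel)
        = (\<integral>\<^sup>+ y. (indicator A (T x + (-1) *\<^sub>R y) :: ennreal) \<partial>lborel)"
      by simp
    also have "\<dots> = (\<integral>\<^sup>+ y. indicator A y \<partial>distr lborel borel (\<lambda>y. T x + (-1) *\<^sub>R y))"
      by (rule nn_integral_distr[symmetric]) measurable
    also have "distr lborel borel (\<lambda>y. T x + (-1) *\<^sub>R y) = lborel"
      using lborel_affine[of "-1" "T x"] by (simp add: density_1)
    also have "(\<integral>\<^sup>+ y. indicator A y \<partial>lborel) = emeasure lborel A"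
      by simp
    finally show "(\<integral>\<^sup>+ y. indicator B (T x) * indicator A (T x - y) \<partial>lborel)
        = indicator B x * emeasure lborel A"
      by (simp add: nn_integral_cmult TB indicator_def)
  qed
  also have "\<dots> = emeasure lborel B * emeasure lborel A"
    by (simp add: nn_integral_multc)
  finally have "emeasure (distr lborel borel T) A * emeasure lborel B
      = emeasure lborel A * emeasure lborel B"
    by (simp add: mult.commute)
  \<comment> \<open>The unit ball has positive finite measure, so its factor cancels even when
    \<open>A\<close> has infinite measure.\<close>
  moreover have "emeasure lborel B \<noteq> 0"
    by (metis B_def content_ball_pos emeasure_eq_measure2 emeasure_lborel_ball_finite
        ennreal_0 less_numeral_extra(1) measure_def enn2real_0 less_irrefl)
  moreover have "emeasure lborel B \<noteq> \<infinity>"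
    unfolding B_def by (metis emeasure_lborel_ball_finite infinity_ennreal_def less_irrefl)
  ultimately show "emeasure (distr lborel borel T) A = emeasure lborel A"
    by (metis ennreal_mult_cancel_left infinity_ennreal_def mult.commute)
qed simp

text \<open>Dilations scale Lebesgue measure by \<open>c ^ DIM('a)\<close> and orthogonal maps
  preserve it. This is the change of variables that compares two gradients of different length and
  direction.\<close>

lemma lborel_integral_similarity:
  fixes f :: "'a::euclidean_space \<Rightarrow> real" and T :: "'a \<Rightarrow> 'a"
  assumes T: "orthogonal_transformation T" and c: "0 < c"
    and [measurable]: "f \<in> borel_measurable borel"
  shows "(\<integral>y. f y \<partial>lborel) = c ^ DIM('a) * (\<integral>y. f (c *\<^sub>R T y) \<partial>lborel)"
proof -
  note [measurable] = borel_measurable_orthogonal_transformation[OF T]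
  have "lborel = density (distr lborel borel (\<lambda>x::'a. c *\<^sub>R x)) (\<lambda>_. ennreal (c ^ DIM('a)))"
    using lborel_affine[of c "0::'a"] c by simp
  hence "(\<integral>y. f y \<partial>lborel)
      = (\<integral>y. f y \<partial>density (distr lborel borel (\<lambda>x::'a. c *\<^sub>R x)) (\<lambda>_. ennreal (c ^ DIM('a))))"
    by simp
  also have "\<dots> = c ^ DIM('a) * (\<integral>y. f (c *\<^sub>R y) \<partial>lborel)"
    using c by (subst integral_density) (auto simp: integral_distr)
  also have "(\<integral>y. f (c *\<^sub>R y) \<partial>lborel) = (\<integral>y. f (c *\<^sub>R y) \<partial>distr lborel borel T)"
    by (simp add: lborel_distr_orthogonal_transformation[OF T])
  also have "\<dots> = (\<integral>y. f (c *\<^sub>R T y) \<partial>lborel)"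
    by (rule integral_distr) measurable
  finally show ?thesis .
qed

section \<open>Powers of the norm\<close>

text \<open>The junk value \<open>0 powr s = 0\<close> makes these integrands vanish at the origin even when
  \<open>s < 0\<close>.\<close>
lemma nn_integral_norm_powr_dyadic:
  fixes S :: "'a::euclidean_space set" and s :: real
  defines "d \<equiv> s + real DIM('a)"
  assumes [measurable]: "S \<in> sets borel" and r: "0 < r" and b: "0 < b" "b powr d < 1"
    and cover: "\<And>y. y \<in> S \<Longrightarrow> \<exists>j::nat. r * b ^ j \<le> norm y \<and> norm y < 2 * (r * b ^ j)"
  shows "(\<integral>\<^sup>+ y. ennreal (norm y powr s) * indicator S y \<partial>lborel)
    \<le> ennreal (2 powr \<bar>s\<bar> * 2 ^ DIM('a) * measure lborel (ball (0::'a) 1) * r powr d / (1 - b powr d))"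
proof -
  \<comment> \<open>The shell between the radii \<open>a j\<close> and \<open>2 * a j\<close> has
    volume of order \<open>a j\<close> to the dimension, and the power is of order
    \<open>a j powr s\<close> on it. The contributions form a geometric series of ratio
    \<open>b powr d\<close>.\<close>
  define a where "a j = r * b ^ j" for j :: nat
  have a: "0 < a j" for j using r b by (simp add: a_def)
  define A :: "nat \<Rightarrow> 'a set" where "A j = {y. a j \<le> norm y \<and> norm y < 2 * a j}" for j
  have [measurable]: "A j \<in> sets borel" for j
    unfolding A_def by measurable
  define W where "W = 2 powr \<bar>s\<bar> * 2 ^ DIM('a) * measure lborel (ball (0::'a) 1)"
  have W: "0 \<le> W" by (simp add: W_def)
  have ball: "emeasure lborel (ball (0::'a) t) = ennreal (measure lborel (ball (0::'a) t))" for t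
    using emeasure_lborel_ball_finite[of "0::'a" t]
    by (intro emeasure_eq_ennreal_measure) simp
  have shell: "(\<integral>\<^sup>+ y. ennreal (norm y powr s) * indicator (A j) y \<partial>lborel)
      \<le> ennreal (W * r powr d * (b powr d) ^ j)" for j
  proof -
    \<comment> \<open>The power is largest at the outer radius if \<open>s\<close> is nonnegative
      and at the inner one otherwise; the factor \<open>2 powr \<bar>s\<bar>\<close> covers both
      cases.\<close>
    have le: "norm y powr s \<le> 2 powr \<bar>s\<bar> * a j powr s" if "y \<in> A j" for y
    proof (cases "s \<ge> 0")
      case True
      have "norm y powr s \<le> (2 * a j) powr s"
        using that True by (intro powr_mono2) (auto simp: A_def)
      thus ?thesis using True a[of j] by (simp add: powr_mult)
    next
      case False
      have "norm y powr s \<le> a j powr s"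
        using that False a[of j] by (intro powr_mono2') (auto simp: A_def)
      also have "\<dots> \<le> 2 powr \<bar>s\<bar> * a j powr s"
        using ge_one_powr_ge_zero[of 2 "\<bar>s\<bar>"]
        by (intro mult_le_cancel_right1[THEN iffD2]) auto
      finally show ?thesis .
    qed
    have "(\<integral>\<^sup>+ y. ennreal (norm y powr s) * indicator (A j) y \<partial>lborel)
        \<le> (\<integral>\<^sup>+ y. ennreal (2 powr \<bar>s\<bar> * a j powr s) * indicator (ball 0 (2 * a j)) y \<partial>(lborel :: 'a measure))"
      using le by (intro nn_integral_mono) (auto simp: A_def split: split_indicator intro!: ennreal_leI)
    also have "\<dots> = ennreal (2 powr \<bar>s\<bar> * a j powr s) * ennreal (measure lborel (ball (0::'a) (2 * a j)))"
      by (subst nn_integral_cmult_indicator)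
         (simp_all add: ball)
    also have "\<dots> = ennreal (2 powr \<bar>s\<bar> * a j powr s * measure lborel (ball (0::'a) (2 * a j)))"
      by (simp add: ennreal_mult)
    also have "measure lborel (ball (0::'a) (2 * a j)) = 2 ^ DIM('a) * a j powr real DIM('a) * measure lborel (ball (0::'a) 1)"
      using a[of j] by (simp add: content_ball_conv_unit_ball[of "2 * a j"] power_mult_distrib powr_realpow)
    also have "2 powr \<bar>s\<bar> * a j powr s * (2 ^ DIM('a) * a j powr real DIM('a) * measure lborel (ball (0::'a) 1))
        = W * a j powr d"
      by (simp add: W_def d_def powr_add mult_ac)
    also have "a j powr d = r powr d * (b powr d) ^ j"
      using r b by (simp add: a_def powr_mult powr_powr powr_realpow[symmetric] mult.commute)
    finally show ?thesis by (simp add: mult_ac)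
  qed
  have "(\<integral>\<^sup>+ y. ennreal (norm y powr s) * indicator S y \<partial>lborel)
      \<le> (\<integral>\<^sup>+ y. (\<Sum>j. ennreal (norm y powr s) * indicator (A j) y) \<partial>lborel)"
  proof (rule nn_integral_mono)
    fix y :: 'a
    show "ennreal (norm y powr s) * indicator S y \<le> (\<Sum>j. ennreal (norm y powr s) * indicator (A j) y)"
    proof (cases "y \<in> S")
      case True
      then obtain j where j: "y \<in> A j" using cover by (auto simp: A_def a_def)
      define g where "g = (\<lambda>i. ennreal (norm y powr s) * indicator (A i) y)"
      have "sum g {j} \<le> suminf g"
        by (rule sum_le_suminf) auto
      thus ?thesis using True j by (simp add: g_def del: ennreal_suminf_cmult)
    qed simp
  qed
  also have "\<dots> = (\<Sum>j. \<integral>\<^sup>+ y. ennreal (norm y powr s) * indicator (A j) y \<partial>lborel)"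
    by (rule nn_integral_suminf) measurable
  also have "\<dots> \<le> (\<Sum>j. ennreal (W * r powr d * (b powr d) ^ j))"
    by (intro suminf_le shell) auto
  also have "\<dots> = ennreal (\<Sum>j. W * r powr d * (b powr d) ^ j)"
    using b W by (intro suminf_ennreal2 summable_mult summable_geometric) auto
  also have "(\<Sum>j. W * r powr d * (b powr d) ^ j) = W * r powr d / (1 - b powr d)"
    using b by (simp add: suminf_mult summable_geometric suminf_geometric)
  finally show ?thesis by (simp add: W_def)
qed

text \<open>Shells of ratio 1/2 shrink towards the origin, and a positive \<open>d\<close> makes
  their sum converge. One \<open>B\<close> serves all radii, so for \<open>s\<close> = 2 - n -
  \<alpha> the bound is of order \<open>r powr (2 - \<alpha>)\<close> and can be made small.\<close>

lemma norm_powr_integrable_ball: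
  fixes s :: real
  defines "d \<equiv> s + real DIM('a::euclidean_space)"
  assumes d: "0 < d"
  obtains B where "0 \<le> B"
    "\<And>r. 0 < r \<Longrightarrow> set_integrable lborel (ball (0::'a) r) (\<lambda>y. norm y powr s)"
    "\<And>r. 0 < r \<Longrightarrow> (LINT y:ball (0::'a) r|lborel. norm y powr s) \<le> B * r powr d"
proof -
  \<comment> \<open>The outermost shell starts at \<open>r / 2\<close>, whence the factor
    \<open>(1/2) powr d\<close>.\<close>
  define B where "B = 2 powr \<bar>s\<bar> * 2 ^ DIM('a) * measure lborel (ball (0::'a) 1) * (1/2) powr d / (1 - (1/2) powr d)"
  have half: "(1/2) powr d < (1::real)"
    using d powr_less_mono2[of d "1/2" 1] by simp
  have B: "0 \<le> B" using half by (simp add: B_def)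
  have nn: "(\<integral>\<^sup>+ y. ennreal (norm y powr s * indicator (ball (0::'a) r) y) \<partial>lborel) \<le> ennreal (B * r powr d)"
    if r: "0 < r" for r
  proof -
    have "(\<integral>\<^sup>+ y. ennreal (norm y powr s * indicator (ball (0::'a) r) y) \<partial>lborel)
        = (\<integral>\<^sup>+ y. ennreal (norm y powr s) * indicator (ball (0::'a) r - {0}) y \<partial>lborel)"
      by (intro nn_integral_cong) (auto split: split_indicator)
    also have "\<dots> \<le> ennreal (2 powr \<bar>s\<bar> * 2 ^ DIM('a) * measure lborel (ball (0::'a) 1) * (r / 2) powr d / (1 - (1/2) powr d))"
      unfolding d_def
    proof (rule nn_integral_norm_powr_dyadic)
      fix y :: 'a assume y: "y \<in> ball 0 r - {0}"
      hence "0 < norm y / r" using r by simp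
      then obtain n where n: "(1/2) ^ n < norm y / r"
        using real_arch_pow_inv[of "norm y / r" "1/2"] by auto
      \<comment> \<open>By minimality \<open>y\<close> lies below the inner radius of the preceding
        shell, which is the outer radius of shell \<open>j\<close>; for \<open>j = 0\<close> that
        outer radius is the radius of the ball.\<close>
      define j where "j = (LEAST j::nat. r / 2 * (1/2) ^ j \<le> norm y)"
      have "r / 2 * (1/2) ^ n \<le> norm y"
      proof -
        have "r / 2 * (1/2) ^ n \<le> r * (1/2) ^ n" using r by simp
        also have "\<dots> \<le> norm y" using n r by (simp add: field_simps)
        finally show ?thesis .
      qed
      hence 1: "r / 2 * (1/2) ^ j \<le> norm y" unfolding j_def by (rule LeastI)
      have 2: "norm y < 2 * (r / 2 * (1/2) ^ j)"
      proof (cases j)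
        case 0 thus ?thesis using y by simp
      next
        case (Suc i)
        hence "\<not> r / 2 * (1/2) ^ i \<le> norm y"
          using not_less_Least[of i "\<lambda>j. r / 2 * (1/2) ^ j \<le> norm y"] unfolding j_def by linarith
        thus ?thesis using Suc by simp
      qed
      show "\<exists>j. r / 2 * (1/2) ^ j \<le> norm y \<and> norm y < 2 * (r / 2 * (1/2) ^ j)"
        using 1 2 by blast
    qed (use r half in \<open>auto simp: d_def\<close>)
    also have "\<dots> = ennreal (B * r powr d)"
      using r powr_mult[of r "1/2" d] by (simp add: B_def mult_ac)
    finally show ?thesis .
  qed
  have int: "set_integrable lborel (ball (0::'a) r) (\<lambda>y. norm y powr s)" if "0 < r" for r
    unfolding set_integrable_def
  proof (rule integrableI_nonneg)
    have [measurable]: "ball (0::'a) r \<in> sets borel" by simp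
    show "(\<lambda>y. indicat_real (ball (0::'a) r) y *\<^sub>R norm y powr s) \<in> borel_measurable lborel"
      by measurable
    show "(\<integral>\<^sup>+ y. ennreal (indicat_real (ball (0::'a) r) y *\<^sub>R norm y powr s) \<partial>lborel) < \<infinity>"
      using le_less_trans[OF nn[OF that]] by (simp add: mult.commute)
  qed simp
  show thesis
  proof
    fix r :: real assume r: "0 < r"
    have "ennreal (LINT y:ball (0::'a) r|lborel. norm y powr s)
        = (\<integral>\<^sup>+ y. ennreal (norm y powr s * indicator (ball (0::'a) r) y) \<partial>lborel)"
      using int[OF r] unfolding set_lebesgue_integral_def set_integrable_def
      by (subst nn_integral_eq_integral[symmetric]) (auto simp: mult.commute)
    with nn[OF r] have "ennreal (LINT y:ball (0::'a) r|lborel. norm y powr s) \<le> ennreal (B * r powr d)"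
      by simp
    thus "(LINT y:ball (0::'a) r|lborel. norm y powr s) \<le> B * r powr d"
      using B by (subst (asm) ennreal_le_iff) auto
  qed (use B int in auto)
qed

text \<open>Shells growing with ratio 2 from radius \<open>r\<close> cover the complement of the
  ball, and a negative \<open>s + real DIM('a)\<close> makes the series converge.\<close>

lemma norm_powr_integrable_outside_ball:
  fixes s :: real
  assumes "s + real DIM('a::euclidean_space) < 0" and r: "0 < r"
  shows "set_integrable lborel (- ball (0::'a) r) (\<lambda>y. norm y powr s)"
proof -
  define d where "d = s + real DIM('a)"
  have d: "d < 0" using assms by (simp add: d_def)
  have two: "2 powr d < (1::real)"
    using d powr_less_mono[of d 0 2] by simp
  have "(\<integral>\<^sup>+ y. ennreal (norm y powr s * indicator (- ball (0::'a) r) y) \<partial>lborel)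
      = (\<integral>\<^sup>+ y. ennreal (norm y powr s) * indicator (- ball (0::'a) r) y \<partial>lborel)"
    by (intro nn_integral_cong) (auto split: split_indicator)
  also have "\<dots> \<le> ennreal (2 powr \<bar>s\<bar> * 2 ^ DIM('a) * measure lborel (ball (0::'a) 1) * r powr d / (1 - 2 powr d))"
    unfolding d_def
  proof (rule nn_integral_norm_powr_dyadic)
    fix y :: 'a assume y: "y \<in> - ball 0 r"
    obtain n where n: "norm y / r < 2 ^ n"
      using real_arch_pow[of 2 "norm y / r"] by auto
    define j where "j = (LEAST j::nat. norm y < 2 * (r * 2 ^ j))"
    have "norm y < r * 2 ^ n" using n r by (simp add: field_simps)
    also have "\<dots> \<le> 2 * (r * 2 ^ n)" using r by simp
    finally have 1: "norm y < 2 * (r * 2 ^ j)" unfolding j_def by (rule LeastI)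
    have 2: "r * 2 ^ j \<le> norm y"
    proof (cases j)
      case 0 thus ?thesis using y by simp
    next
      case (Suc i)
      hence "\<not> norm y < 2 * (r * 2 ^ i)"
        using not_less_Least[of i "\<lambda>j. norm y < 2 * (r * 2 ^ j)"] unfolding j_def by linarith
      thus ?thesis using Suc by simp
    qed
    show "\<exists>j. r * 2 ^ j \<le> norm y \<and> norm y < 2 * (r * 2 ^ j)"
      using 1 2 by blast
  qed (use r two in \<open>auto simp: d_def\<close>)
  finally show ?thesis
    unfolding set_integrable_def
    by (intro integrableI_nonneg) (auto simp: mult.commute intro: le_less_trans)
qed

section \<open>Local analysis of the nonlinear operator\<close>

text \<open>Half-open, so that the complements of the open balls of radii \<open>e\<close> <
  \<open>r\<close> differ by exactly this set.\<close>

definition annulus :: "real \<Rightarrow> real \<Rightarrow> 'a::real_normed_vector set" where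
  "annulus e r = {y. e \<le> norm y \<and> norm y < r}"

lemma annulus_borel [measurable]: "annulus e r \<in> sets (borel :: 'a::real_normed_vector measure)"
proof -
  have "annulus e r = {y::'a. e \<le> norm y} \<inter> {y. norm y < r}"
    by (auto simp: annulus_def)
  thus ?thesis
    by (auto intro!: sets.Int borel_closed borel_open closed_Collect_le open_Collect_less continuous_intros)
qed

lemma annulus_integrable:
  fixes f :: "'a::euclidean_space \<Rightarrow> real"
  assumes f: "continuous_on UNIV f" and e: "0 < e"
  shows "set_integrable lborel (annulus e r) (\<lambda>y. f y / norm y powr b)"
proof (rule set_integrable_subset)
  let ?K = "cball (0::'a) r \<inter> {y. e \<le> norm y}"
  have "compact ?K"
    by (intro compact_Int_closed compact_cball closed_Collect_le continuous_intros)
  moreover have "continuous_on ?K (\<lambda>y. f y / norm y powr b)"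
    using e by (intro continuous_intros continuous_on_subset[OF f]) auto
  ultimately show "set_integrable lborel ?K (\<lambda>y. f y / norm y powr b)"
    unfolding set_integrable_def by (rule borel_integrable_compact)
  show "annulus e r \<subseteq> ?K" by (auto simp: annulus_def)
qed simp

text \<open>With z = x + y the singularity sits at the origin for every centre \<open>x\<close>, so
  that different centres become comparable. The integrand is Borel measurable, which permits passing
  from the completed measure to \<open>lborel\<close>.\<close>

lemma translated_integrand:
  fixes u :: "real ^ 'n::finite \<Rightarrow> real" and \<alpha> :: real
  assumes u: "continuous_on UNIV u" and G: "continuous_on UNIV G"
  defines "f x y \<equiv> G (u x - u (x + y)) / norm y powr (real CARD('n) + \<alpha>)"
  shows F_truncated_eq_lborel:
      "F_truncated \<alpha> G u x e = (LINT y:{y. e \<le> norm y}|lborel. f x y)"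
    and F_integrand_integrable_lborel:
      "set_integrable lebesgue (- ball x e) (F_integrand \<alpha> G u x)
        \<longleftrightarrow> set_integrable lborel {y. e \<le> norm y} (f x)"
proof -
  have [measurable]: "u \<in> borel_measurable borel" "G \<in> borel_measurable borel"
    using u G by (auto intro: borel_measurable_continuous_onI)
  define g where "g z = indicator (- ball x e) z *\<^sub>R F_integrand \<alpha> G u x z" for z
  have "- ball x e \<in> sets borel" by simp
  hence [measurable]: "g \<in> borel_measurable borel"
    unfolding g_def F_integrand_def by measurable
  have g: "g (x + y) = indicator {y. e \<le> norm y} y *\<^sub>R f x y" for y
    by (auto simp: g_def F_integrand_def f_def dist_norm split: split_indicator)
  have "integrable lebesgue g \<longleftrightarrow> integrable (distr lborel borel ((+) x)) g"
    by (simp add: integrable_completion lborel_distr_plus)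
  also have "\<dots> \<longleftrightarrow> integrable lborel (\<lambda>y. g (x + y))"
    by (rule integrable_distr_eq) auto
  finally show "set_integrable lebesgue (- ball x e) (F_integrand \<alpha> G u x)
        \<longleftrightarrow> set_integrable lborel {y. e \<le> norm y} (f x)"
    unfolding set_integrable_def by (simp only: g g_def[symmetric])
  have "integral\<^sup>L lebesgue g = integral\<^sup>L (distr lborel borel ((+) x)) g"
    by (simp add: integral_completion lborel_distr_plus)
  also have "\<dots> = (\<integral>y. g (x + y) \<partial>lborel)"
    by (rule integral_distr) auto
  finally show "F_truncated \<alpha> G u x e = (LINT y:{y. e \<le> norm y}|lborel. f x y)"
    unfolding F_truncated_def set_lebesgue_integral_def by (simp only: g g_def[symmetric])
qed

lemma C1_lipschitz_on_interval:
  fixes G :: "real \<Rightarrow> real"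
  assumes "G C1_differentiable_on UNIV"
  obtains M where "M-lipschitz_on {-R..R} G"
proof -
  obtain D where D: "\<And>t. (G has_vector_derivative D t) (at t)" and cD: "continuous_on UNIV D"
    using assms by (auto simp: C1_differentiable_on_def)
  have "bounded (D ` {-R..R})"
    by (intro compact_imp_bounded compact_continuous_image continuous_on_subset[OF cD]) auto
  then obtain M where M: "0 < M" "\<And>t. t \<in> {-R..R} \<Longrightarrow> norm (D t) \<le> M"
    by (auto simp: bounded_pos)
  have "M-lipschitz_on {-R..R} G"
  proof (rule bounded_derivative_imp_lipschitz)
    fix t assume t: "t \<in> {-R..R}"
    show "(G has_derivative (\<lambda>h. h *\<^sub>R D t)) (at t within {-R..R})"
      using D[of t, unfolded has_vector_derivative_def] by (rule has_derivative_at_withinI)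
    show "onorm (\<lambda>h. h *\<^sub>R D t) \<le> M"
      using M(2)[OF t] by (intro onorm_le) (simp add: abs_mult mult_left_mono mult.commute[of M])
  qed (use M in auto)
  thus thesis by (rule that)
qed

lemma deriv_ge_imp_le:
  fixes G :: "real \<Rightarrow> real"
  assumes "G C1_differentiable_on UNIV" "\<forall>t. c \<le> deriv G t" "s \<le> t"
  shows "G s + c * (t - s) \<le> G t"
proof (cases "s < t")
  case True
  obtain D where D: "\<And>t. (G has_vector_derivative D t) (at t)"
    using assms by (auto simp: C1_differentiable_on_def)
  hence D': "(G has_real_derivative D t) (at t)" for t
    by (simp add: has_real_derivative_iff_has_vector_derivative)
  obtain z where "G t - G s = (t - s) * D z"
    using MVT2[OF True, of G D] D' by blast
  moreover have "c \<le> D z" using assms(2) DERIV_imp_deriv[OF D'[of z]] by metis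
  hence "(t - s) * c \<le> (t - s) * D z" using True by (intro mult_left_mono) auto
  ultimately show ?thesis
    by (simp add: mult.commute)
qed (use assms in simp)

text \<open>The function u(z) - z . Du(x) of z has gradient Du(z) - Du(x), of norm at most L |y| on
  the ball of radius |y| about \<open>x\<close>; the mean value inequality on that ball supplies the
  second factor |y|.\<close>

lemma lipschitz_gradient_taylor:
  fixes u :: "'a::euclidean_space \<Rightarrow> real"
  assumes Du: "\<And>x. GDERIV u x :> Du x" and L: "L-lipschitz_on (cball x r) Du" and y: "norm y \<le> r"
  shows "\<bar>u (x + y) - u x - y \<bullet> Du x\<bar> \<le> L * (norm y)\<^sup>2"
proof -
  have "norm ((u (x + y) - (x + y) \<bullet> Du x) - (u x - x \<bullet> Du x)) \<le> (L * norm y) * norm ((x + y) - x)"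
  proof (rule differentiable_bound)
    show "convex (cball x (norm y))" by simp
    fix z assume z: "z \<in> cball x (norm y)"
    have r: "0 \<le> r" using y norm_ge_zero order_trans by blast
    show "((\<lambda>z. u z - z \<bullet> Du x) has_derivative (\<lambda>h. h \<bullet> Du z - h \<bullet> Du x)) (at z within cball x (norm y))"
      using Du[of z, unfolded gderiv_def, THEN has_derivative_at_withinI]
      by (intro derivative_intros)
    have "norm (Du z - Du x) \<le> L * norm (z - x)"
      using lipschitz_onD[OF L, of z x] z y r by (auto simp: dist_norm norm_minus_commute)
    also have "\<dots> \<le> L * norm y"
      using z lipschitz_on_nonneg[OF L] by (intro mult_left_mono) (auto simp: dist_norm norm_minus_commute)
    finally have 1: "norm (Du z - Du x) \<le> L * norm y" .
    show "onorm (\<lambda>h. h \<bullet> Du z - h \<bullet> Du x) \<le> L * norm y"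
    proof (rule onorm_le)
      fix h
      have "norm (h \<bullet> Du z - h \<bullet> Du x) \<le> norm h * norm (Du z - Du x)"
        using Cauchy_Schwarz_ineq2[of h "Du z - Du x"] by (simp add: inner_diff_right)
      also have "\<dots> \<le> norm h * (L * norm y)" using 1 by (intro mult_left_mono) auto
      finally show "norm (h \<bullet> Du z - h \<bullet> Du x) \<le> L * norm y * norm h" by (simp add: mult_ac)
    qed
  qed (auto simp: dist_norm)
  thus ?thesis by (simp add: inner_add_left power2_eq_square algebra_simps)
qed

text \<open>The annulus integral with the increment u(x) - u(x + y) replaced by its first order
  term, \<open>p\<close> being the gradient at x. The inner cutoff \<open>e\<close> is kept because
  the reflection of y cancels only the odd part of \<open>G\<close>.\<close>

definition linear_part ::
  "real \<Rightarrow> (real \<Rightarrow> real) \<Rightarrow> 'a::euclidean_space \<Rightarrow> real \<Rightarrow> real \<Rightarrow> real" where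
  "linear_part b G p e r = (LINT y:annulus e r|lborel. G (- (p \<bullet> y)) / norm y powr b)"

text \<open>When y is replaced by \<open>c *\<^sub>R T y\<close>, the product p . y becomes q . y,
  so the nonlinear \<open>G\<close> sees the same values. Only the kernel and the volume change, by
  c^(-n-\<alpha>) and c^n, which leaves c^(-\<alpha>) = l^\<alpha>.\<close>

lemma linear_part_rescale:
  fixes p q :: "real ^ 'n::finite"
  assumes G: "continuous_on UNIV G" and q: "q \<noteq> 0" and p: "p \<noteq> 0"
  defines "l \<equiv> norm p / norm q"
  shows "linear_part (real CARD('n) + \<alpha>) G p e r
    = l powr \<alpha> * linear_part (real CARD('n) + \<alpha>) G q (l * e) (l * r)"
proof -
  let ?b = "real CARD('n) + \<alpha>"
  have [measurable]: "G \<in> borel_measurable borel"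
    using G by (rule borel_measurable_continuous_onI)
  have l: "0 < l" using p q by (simp add: l_def)
  \<comment> \<open>This factor gives \<open>p\<close> the length of \<open>q\<close>, so that some
    orthogonal map, possibly a reflection, carries \<open>q\<close> to
    \<open>c *\<^sub>R p\<close>.\<close>
  define c where "c = inverse l"
  have c: "0 < c" using l by (simp add: c_def)
  have "norm q = norm (c *\<^sub>R p)" using p q by (simp add: c_def l_def)
  then obtain T where T: "orthogonal_transformation T" and Tq: "T q = c *\<^sub>R p"
    by (rule orthogonal_transformation_exists)
  have inner: "p \<bullet> (c *\<^sub>R T y) = q \<bullet> y" for y
    using T by (metis Tq inner_scaleR_left inner_scaleR_right orthogonal_transformation_def)
  have norm: "norm (c *\<^sub>R T y) = c * norm y" for y
    using c by (simp add: orthogonal_transformation_norm[OF T])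
  have ind: "indicator (annulus e r) (c *\<^sub>R T y) = (indicator (annulus (l * e) (l * r)) y :: real)" for y
    using l unfolding indicator_def annulus_def mem_Collect_eq norm
    by (simp add: c_def field_simps)
  have scale: "i *\<^sub>R (v / (c * norm y) powr ?b) = c powr (- ?b) * (i *\<^sub>R (v / norm y powr ?b))"
    for i v :: real and y :: "real ^ 'n"
    unfolding powr_minus_divide[of c ?b] using c by (simp add: powr_mult)
  have "linear_part ?b G p e r
      = (\<integral>y. indicator (annulus e r) y *\<^sub>R (G (- (p \<bullet> y)) / norm y powr ?b) \<partial>lborel)"
    by (simp add: linear_part_def set_lebesgue_integral_def)
  also have "\<dots> = c ^ DIM(real ^ 'n) * (\<integral>y. indicator (annulus e r) (c *\<^sub>R T y) *\<^sub>R
      (G (- (p \<bullet> (c *\<^sub>R T y))) / norm (c *\<^sub>R T y) powr ?b) \<partial>lborel)"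
    by (rule lborel_integral_similarity[OF T c]) measurable
  also have "\<dots> = c ^ CARD('n) * (\<integral>y. c powr (- ?b) * (indicator (annulus (l * e) (l * r)) y *\<^sub>R
      (G (- (q \<bullet> y)) / norm y powr ?b)) \<partial>lborel)"
    unfolding inner norm ind scale by simp
  also have "\<dots> = c ^ CARD('n) * c powr (- ?b) * linear_part ?b G q (l * e) (l * r)"
    unfolding linear_part_def set_lebesgue_integral_def
    by (subst integral_mult_right_zero) (rule mult.assoc[symmetric])
  also have "c ^ CARD('n) * c powr (- ?b) = c powr (real CARD('n) + - ?b)"
    unfolding powr_add using c by (simp add: powr_realpow)
  also have "\<dots> = l powr \<alpha>"
    using l by (simp add: c_def powr_minus inverse_powr)
  finally show ?thesis .
qed

text \<open>For |y| < r both arguments of \<open>G\<close> lie in the interval where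
  \<open>G\<close> is \<open>M\<close>-Lipschitz, and they differ by at most L |y|^2. The integrands
  thus differ by at most M L |y|^(2 - b), whose integral over the whole ball bounds the error
  independently of \<open>e\<close>.\<close>

lemma near_part_linearisation:
  fixes u :: "'a::euclidean_space \<Rightarrow> real"
  assumes u: "continuous_on UNIV u" and G: "continuous_on UNIV G"
    and taylor: "\<And>y. norm y \<le> 1 \<Longrightarrow> \<bar>u (x + y) - u x - y \<bullet> p\<bar> \<le> L * (norm y)\<^sup>2"
    and M: "M-lipschitz_on {-R..R} G" and R: "norm p + L \<le> R" and L: "0 \<le> L"
    and e: "0 < e" and r: "0 < r" "r \<le> 1"
    and int: "set_integrable lborel (ball (0::'a) r) (\<lambda>y. norm y powr (2 - b))"
    and B: "(LINT y:ball (0::'a) r|lborel. norm y powr (2 - b)) \<le> B"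
  shows "\<bar>(LINT y:annulus e r|lborel. G (u x - u (x + y)) / norm y powr b) - linear_part b G p e r\<bar>
    \<le> M * L * B"
proof -
  have M0: "0 \<le> M" using M by (rule lipschitz_on_nonneg)
  have c1: "continuous_on UNIV (\<lambda>y. G (u x - u (x + y)))"
    by (intro continuous_on_compose2[OF G] continuous_on_compose2[OF u] continuous_intros) auto
  have c2: "continuous_on UNIV (\<lambda>y. G (- (p \<bullet> y)))"
    by (intro continuous_on_compose2[OF G] continuous_intros) auto
  let ?D = "\<lambda>y. G (u x - u (x + y)) / norm y powr b - G (- (p \<bullet> y)) / norm y powr b"
  note i1 = annulus_integrable[OF c1 e, of r b] and i2 = annulus_integrable[OF c2 e, of r b]
  have ball: "set_integrable lborel (ball (0::'a) r) (\<lambda>y. M * L * norm y powr (2 - b))"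
    using int by simp
  hence ann: "set_integrable lborel (annulus e r :: 'a set) (\<lambda>y. M * L * norm y powr (2 - b))"
    by (rule set_integrable_subset) (auto simp: annulus_def)
  have "\<bar>(LINT y:annulus e r|lborel. G (u x - u (x + y)) / norm y powr b) - linear_part b G p e r\<bar>
      = \<bar>LINT y:annulus e r|lborel. ?D y\<bar>"
    unfolding linear_part_def using i1 i2 by simp
  also have "\<dots> \<le> (LINT y:annulus e r|lborel. \<bar>?D y\<bar>)"
    using set_integral_norm_bound[OF set_integral_diff(1)[OF i1 i2]] by simp
  also have "\<dots> \<le> (LINT y:(annulus e r :: 'a set)|lborel. M * L * norm y powr (2 - b))"
  proof (rule set_integral_mono)
    show "set_integrable lborel (annulus e r) (\<lambda>y. \<bar>?D y\<bar>)"
      using set_integrable_norm[OF set_integral_diff(1)[OF i1 i2]] by simp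
    fix y :: 'a assume "y \<in> annulus e r"
    hence y: "0 < norm y" "norm y \<le> 1" using e r by (auto simp: annulus_def)
    have sq: "(norm y)\<^sup>2 \<le> 1" using y by (intro power_le_one) auto
    have py: "\<bar>p \<bullet> y\<bar> \<le> norm p"
      using Cauchy_Schwarz_ineq2[of p y] y mult_left_mono[of "norm y" 1 "norm p"] by simp
    have t: "\<bar>u (x + y) - u x - p \<bullet> y\<bar> \<le> L * (norm y)\<^sup>2"
      using taylor[OF y(2)] by (simp add: inner_commute)
    moreover have "L * (norm y)\<^sup>2 \<le> L" using L sq mult_left_mono[OF sq L] by simp
    ultimately have "u x - u (x + y) \<in> {-R..R}" "- (p \<bullet> y) \<in> {-R..R}"
      using py R L by auto
    hence "\<bar>G (u x - u (x + y)) - G (- (p \<bullet> y))\<bar> \<le> M * \<bar>u x - u (x + y) - (- (p \<bullet> y))\<bar>"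
      using lipschitz_onD[OF M] unfolding dist_real_def by blast
    also have "\<dots> \<le> M * (L * (norm y)\<^sup>2)"
      using t M0 by (intro mult_left_mono) auto
    finally have "\<bar>?D y\<bar> \<le> M * (L * (norm y)\<^sup>2) / norm y powr b"
      by (simp add: diff_divide_distrib[symmetric] abs_divide divide_right_mono)
    also have "\<dots> = M * L * norm y powr (2 - b)"
      using y by (simp add: powr_diff powr_numeral)
    finally show "\<bar>?D y\<bar> \<le> M * L * norm y powr (2 - b)" .
  qed (rule ann)
  also have "\<dots> \<le> (LINT y:ball (0::'a) r|lborel. M * L * norm y powr (2 - b))"
    using ann ball M0 L unfolding set_lebesgue_integral_def set_integrable_def
    by (intro integral_mono) (auto simp: annulus_def split: split_indicator)
  also have "\<dots> \<le> M * L * B"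
    using B M0 L by (simp add: mult_left_mono)
  finally show ?thesis .
qed

text \<open>Only the annulus term depends on \<open>e\<close>; the part outside radius
  \<open>r\<close> stays fixed as the cutoff shrinks.\<close>

lemma F_truncated_split:
  fixes u :: "real ^ 'n::finite \<Rightarrow> real" and \<alpha> :: real
  assumes u: "continuous_on UNIV u" and G: "continuous_on UNIV G"
    and F: "F_defined \<alpha> G u x" and er: "0 < e" "e < r"
  shows "F_truncated \<alpha> G u x e = F_truncated \<alpha> G u x r
    + (LINT y:annulus e r|lborel. G (u x - u (x + y)) / norm y powr (real CARD('n) + \<alpha>))"
proof -
  let ?f = "\<lambda>y. G (u x - u (x + y)) / norm y powr (real CARD('n) + \<alpha>)"
  have int: "set_integrable lborel {y. e \<le> norm y} ?f"
    using F er F_integrand_integrable_lborel[OF u G] by (simp add: F_defined_def)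
  have "{y. r \<le> norm y} \<in> sets (borel :: (real ^ 'n) measure)"
    by (intro borel_closed closed_Collect_le continuous_intros)
  hence "set_integrable lborel {y. r \<le> norm y} ?f" "set_integrable lborel (annulus e r) ?f"
    using er by (auto intro!: set_integrable_subset[OF int] simp: annulus_def)
  moreover have "{y. e \<le> norm y} = {y::real^'n. r \<le> norm y} \<union> annulus e r"
    using er by (auto simp: annulus_def)
  ultimately show ?thesis
    unfolding F_truncated_eq_lborel[OF u G]
    by (simp add: set_integral_Un annulus_def disjoint_iff)
qed

text \<open>Existence of the limit is turned into a bound: an annulus integral is a difference of
  two truncations, both within 1 of the limit, hence at most 2 in absolute value. Passing to the
  linear part adds at most \<open>M * L * B\<close>.\<close>

lemma linear_part_bounded:
  fixes u :: "real ^ 'n::finite \<Rightarrow> real" and \<alpha> :: real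
  assumes u: "continuous_on UNIV u" and G: "continuous_on UNIV G"
    and \<alpha>: "\<alpha> < 2" and F: "F_defined \<alpha> G u x"
    and taylor: "\<And>y. norm y \<le> 1 \<Longrightarrow> \<bar>u (x + y) - u x - y \<bullet> p\<bar> \<le> L * (norm y)\<^sup>2"
    and M: "M-lipschitz_on {-R..R} G" and R: "norm p + L \<le> R" and L: "0 \<le> L"
  obtains K \<eta> where "0 < \<eta>"
    "\<And>e r. 0 < e \<Longrightarrow> e < r \<Longrightarrow> r \<le> \<eta> \<Longrightarrow> \<bar>linear_part (real CARD('n) + \<alpha>) G p e r\<bar> \<le> K"
proof -
  let ?b = "real CARD('n) + \<alpha>"
  let ?T = "F_truncated \<alpha> G u x"
  have "0 < (2 - ?b) + real DIM(real ^ 'n)" using \<alpha> by simp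
  then obtain B where B: "0 \<le> B"
    "\<And>r. 0 < r \<Longrightarrow> set_integrable lborel (ball (0::real^'n) r) (\<lambda>y. norm y powr (2 - ?b))"
    "\<And>r. 0 < r \<Longrightarrow> (LINT y:ball (0::real^'n) r|lborel. norm y powr (2 - ?b))
        \<le> B * r powr ((2 - ?b) + real DIM(real ^ 'n))"
    by (rule norm_powr_integrable_ball) blast
  obtain l where "(?T \<longlongrightarrow> l) (at_right 0)"
    using F by (auto simp: F_defined_def)
  hence "eventually (\<lambda>e. dist (?T e) l < 1) (at_right 0)"
    by (rule tendstoD) simp
  then obtain \<eta>0 where \<eta>0: "0 < \<eta>0" "\<And>e. 0 < e \<Longrightarrow> e < \<eta>0 \<Longrightarrow> dist (?T e) l < 1"
    by (auto simp: eventually_at_right_field)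
  \<comment> \<open>At most 1 for the Taylor bound, and half of \<open>\<eta>0\<close> because
    \<open>r \<le> \<eta>\<close> must yield the strict \<open>r < \<eta>0\<close>.\<close>
  define \<eta> where "\<eta> = min 1 (\<eta>0 / 2)"
  show thesis
  proof
    show "0 < \<eta>" using \<eta>0 by (simp add: \<eta>_def)
    fix e r assume er: "0 < e" "e < r" "r \<le> \<eta>"
    hence r: "0 < r" "r \<le> 1" "r < \<eta>0" "e < \<eta>0" using \<eta>0(1) by (auto simp: \<eta>_def)
    let ?I = "LINT y:annulus e r|lborel. G (u x - u (x + y)) / norm y powr ?b"
    have "?I = ?T e - ?T r"
      using F_truncated_split[OF u G F er(1,2)] by simp
    hence "\<bar>?I\<bar> \<le> 2"
      using \<eta>0(2)[of e] \<eta>0(2)[of r] er r by (simp add: dist_real_def)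
    moreover have "B * r powr ((2 - ?b) + real DIM(real ^ 'n)) \<le> B"
      using B(1) r \<alpha> powr_mono2[of "2 - \<alpha>" r 1] by (simp add: mult_left_le)
    hence "(LINT y:ball (0::real^'n) r|lborel. norm y powr (2 - ?b)) \<le> B"
      using B(3)[OF r(1)] by simp
    hence "\<bar>?I - linear_part ?b G p e r\<bar> \<le> M * L * B"
      by (intro near_part_linearisation[OF u G taylor M R L er(1) r(1,2) B(2)[OF r(1)]])
    ultimately show "\<bar>linear_part ?b G p e r\<bar> \<le> 2 + M * L * B" by linarith
  qed
qed

text \<open>As u is nonnegative, the numerator is at most G(u(x)) everywhere. On the ball about
  \<open>a\<close> the increment is at most -m/2, so the numerator is at most -\<kappa>, against a
  kernel of at least D^(-b). In the application the first term tends to 0 with u(x), while the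
  second does not depend on x.\<close>

lemma far_part_upper_bound:
  fixes u :: "'a::euclidean_space \<Rightarrow> real"
  assumes G: "\<And>s t. s \<le> t \<Longrightarrow> G s \<le> G t" "G 0 = 0" and u: "\<And>z. 0 \<le> u z"
    and m: "\<And>z. z \<in> ball a s \<Longrightarrow> m \<le> u z" "u x \<le> m / 2"
    and \<kappa>: "0 \<le> \<kappa>" "G (- (m / 2)) \<le> - \<kappa>"
    and D: "\<And>z. z \<in> ball a s \<Longrightarrow> r \<le> norm (z - x) \<and> norm (z - x) \<le> D"
    and r: "0 < r" and s: "0 < s" and b: "real DIM('a) < b"
    and int: "set_integrable lborel {y. r \<le> norm y} (\<lambda>y. G (u x - u (x + y)) / norm y powr b)"
  shows "(LINT y:{y. r \<le> norm y}|lborel. G (u x - u (x + y)) / norm y powr b)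
    \<le> G (u x) * (LINT y:- ball (0::'a) r|lborel. norm y powr - b)
      - \<kappa> * D powr - b * measure lborel (ball (0::'a) s)"
proof -
  let ?S = "{y::'a. r \<le> norm y}"
  let ?A = "ball (a - x) s"
  have S: "?S = - ball 0 r" by auto
  have A: "x + y \<in> ball a s \<longleftrightarrow> y \<in> ?A" for y
    by (simp add: dist_norm algebra_simps)
  \<comment> \<open>Seen from \<open>x\<close>, the ball about \<open>a\<close> avoids the deleted
    ball, so the correction term integrates to its full measure.\<close>
  have AS: "?A \<subseteq> ?S" using D A by fastforce
  have 1: "set_integrable lborel ?S (\<lambda>y. G (u x) * norm y powr - b)"
    unfolding S using norm_powr_integrable_outside_ball[where 'a='a, of "- b" r] b r by simp
  have 2: "set_integrable lborel ?S (\<lambda>y. \<kappa> * D powr - b * indicator ?A y)"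
  proof (rule set_integrable_subset)
    show "set_integrable lborel UNIV (\<lambda>y. \<kappa> * D powr - b * indicator ?A y :: real)"
      unfolding set_integrable_def
      by (simp add: emeasure_lborel_ball_finite[unfolded infinity_ennreal_def])
  qed (auto simp: S)
  have "(LINT y:?S|lborel. G (u x - u (x + y)) / norm y powr b)
      \<le> (LINT y:?S|lborel. G (u x) * norm y powr - b - \<kappa> * D powr - b * indicator ?A y)"
  proof (rule set_integral_mono[OF int])
    show "set_integrable lborel ?S (\<lambda>y. G (u x) * norm y powr - b - \<kappa> * D powr - b * indicator ?A y)"
      by (rule set_integral_diff(1)[OF 1 2])
    fix y assume y: "y \<in> ?S"
    have b0: "0 < b" using b by (meson le_less_trans of_nat_0_le_iff)
    have Gx: "0 \<le> G (u x)" using G(1)[of 0 "u x"] G(2) u by simp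
    show "G (u x - u (x + y)) / norm y powr b \<le> G (u x) * norm y powr - b - \<kappa> * D powr - b * indicator ?A y"
    proof (cases "y \<in> ?A")
      case True
      hence z: "x + y \<in> ball a s" using A by blast
      have "G (u x - u (x + y)) \<le> G (- (m / 2))"
        using m(1)[OF z] m(2) by (intro G) simp
      hence "G (u x - u (x + y)) \<le> - \<kappa>" using \<kappa> by simp
      hence "G (u x - u (x + y)) * norm y powr - b \<le> - \<kappa> * norm y powr - b"
        by (intro mult_right_mono) auto
      also have "D powr - b \<le> norm y powr - b"
        using D[OF z] r b0 by (intro powr_mono2') auto
      hence "- \<kappa> * norm y powr - b \<le> - \<kappa> * D powr - b"
        using \<kappa> by (simp add: mult_left_mono)
      also have "\<dots> \<le> G (u x) * norm y powr - b - \<kappa> * D powr - b"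
        using Gx by simp
      finally show ?thesis using True by (simp add: powr_minus_divide)
    next
      case False
      have "G (u x - u (x + y)) \<le> G (u x)" using u by (intro G) simp
      thus ?thesis using False by (simp add: powr_minus_divide divide_right_mono)
    qed
  qed
  also have "\<dots> = G (u x) * (LINT y:?S|lborel. norm y powr - b)
      - (LINT y:?S|lborel. \<kappa> * D powr - b * indicator ?A y)"
    by (simp add: set_integral_diff(2)[OF 1 2])
  also have "(LINT y:?S|lborel. \<kappa> * D powr - b * indicator ?A y)
      = (\<integral>y. \<kappa> * D powr - b * indicator ?A y \<partial>lborel)"
    unfolding set_lebesgue_integral_def
    using AS by (intro Bochner_Integration.integral_cong) (auto split: split_indicator)
  also have "\<dots> = \<kappa> * D powr - b * measure lborel ?A"
    by simp
  also have "measure lborel ?A = measure lborel (ball (0::'a) s)"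
    using s content_ball_conv_unit_ball[of s "a - x"] content_ball_conv_unit_ball[of s "0::'a"] by simp
  finally show ?thesis by (simp add: S)
qed

lemma gradient_zero_at_minimum:
  assumes "GDERIV u x :> D" "\<And>y. u x \<le> u y"
  shows "D = 0"
proof -
  have "(\<lambda>h. h \<bullet> D) = (\<lambda>h. 0)"
    using assms differential_zero_maxmin[of x UNIV u "\<lambda>h. h \<bullet> D"] by (auto simp: gderiv_def)
  hence "D \<bullet> D = 0" by metis
  thus ?thesis by simp
qed

lemma gradient_zero_imp_constant:
  assumes "\<And>x. GDERIV u x :> 0"
  shows "u x = u y"
  using assms has_derivative_zero_unique[of UNIV u y x]
  by (auto simp: gderiv_def)

section \<open>The Liouville theorem\<close>

theorem theorem6:
  fixes u :: "real ^ 'n::finite \<Rightarrow> real" and k :: 'n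
    and G h :: "real \<Rightarrow> real" and \<alpha> c0 C :: real
  assumes "0 < \<alpha>" and "\<alpha> < 2" and "0 < C"
    and "G C1_differentiable_on UNIV" and "G 0 = 0"
    and "0 < c0" and "\<forall>t. c0 \<le> deriv G t"
    and "u \<in> L_space \<alpha>" and "C11_loc u"
    and "\<forall>x. 0 \<le> u x"
    and "\<forall>x\<in>half_space k. F_defined \<alpha> G u x \<and> F_op C \<alpha> G u x = h (u x)"
    and "\<forall>x. x \<notin> half_space k \<longrightarrow> u x = 0"
    and "(u \<longlongrightarrow> 0) at_infinity"
    and "\<exists>L. L-lipschitz_on (range u) h"
    and "h 0 = 0"
  shows "\<forall>x. u x = 0"
proof (rule ccontr)
  assume "\<not> (\<forall>x. u x = 0)"
  then obtain a where a: "u a \<noteq> 0" by blast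
  have \<alpha>: "0 < \<alpha>" "\<alpha> < 2" by fact+
  define b where "b = real CARD('n) + \<alpha>"
  have u0: "0 \<le> u x" for x using assms(10) by blast
  have hs: "x \<in> half_space k" if "u x \<noteq> 0" for x using assms(12) that by blast
  have F: "F_defined \<alpha> G u x" "F_op C \<alpha> G u x = h (u x)" if "x \<in> half_space k" for x
    using assms(11) that by auto
  \<comment> \<open>The origin lies on the boundary hyperplane, outside the open half space; it is
    the point to be approached.\<close>
  have uo: "u 0 = 0" using hs[of 0] by (auto simp: half_space_def)

  \<comment> \<open>Regularity of u and monotonicity of G\<close>
  obtain Du where Du: "\<And>x. GDERIV u x :> Du x"
    and Du_lip: "\<And>K. compact K \<Longrightarrow> \<exists>L. L-lipschitz_on K Du"
    using \<open>C11_loc u\<close> unfolding C11_loc_def by blast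
  have cu: "continuous_on UNIV u"
    using Du by (intro has_derivative_continuous_on[where f' = "\<lambda>x h. h \<bullet> Du x"]) (simp add: gderiv_def)
  have cG: "continuous_on UNIV G"
    using C1_diff_imp_diff[OF assms(4)] by (rule differentiable_imp_continuous_on)
  have G_le: "G s + c0 * (t - s) \<le> G t" if "s \<le> t" for s t
    using deriv_ge_imp_le[OF assms(4,7) that] .
  have G_mono: "G s \<le> G t" if "s \<le> t" for s t
  proof -
    have "0 \<le> c0 * (t - s)" using that \<open>0 < c0\<close> by (intro mult_nonneg_nonneg) auto
    thus ?thesis using G_le[OF that] by linarith
  qed
  \<comment> \<open>Every zero of u is a global minimum, so the gradient vanishes on the whole
    complement of the half space, boundary included.\<close>
  have Du_zero: "Du x = 0" if "u x = 0" for x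
    using gradient_zero_at_minimum[OF Du] u0 that by simp

  \<comment> \<open>A reference point with nonzero gradient\<close>
  obtain x1 where x1: "Du x1 \<noteq> 0"
    using gradient_zero_imp_constant[of u a 0] Du a uo by metis
  \<comment> \<open>A nonzero gradient excludes u(x1) = 0, so the equation, and with it the
    existence of the limit, is available at \<open>x1\<close>.\<close>
  hence x1_hs: "x1 \<in> half_space k" using Du_zero hs by blast
  obtain K \<eta> where \<eta>: "0 < \<eta>"
    and K: "\<And>e r. 0 < e \<Longrightarrow> e < r \<Longrightarrow> r \<le> \<eta> \<Longrightarrow> \<bar>linear_part b G (Du x1) e r\<bar> \<le> K"
  proof -
    obtain L where L: "L-lipschitz_on (cball x1 1) Du" using Du_lip[of "cball x1 1"] by auto
    obtain M where M: "M-lipschitz_on {- (norm (Du x1) + L)..norm (Du x1) + L} G"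
      using C1_lipschitz_on_interval[OF assms(4)] .
    show ?thesis
      by (rule linear_part_bounded[OF cu cG \<alpha>(2) F(1)[OF x1_hs] lipschitz_gradient_taylor[OF Du L]
            M order_refl lipschitz_on_nonneg[OF L], folded b_def], assumption, rule that)
  qed

  \<comment> \<open>Uniform constants near the origin\<close>
  obtain L where L: "L-lipschitz_on (cball 0 2) Du" using Du_lip[of "cball 0 2"] by auto
  have L0: "0 \<le> L" using L by (rule lipschitz_on_nonneg)
  \<comment> \<open>For |x| \<le> 1 the unit ball about x lies in the ball of radius 2, and
    \<open>Du 0 = 0\<close> gives |Du(x)| \<le> L. All arguments of \<open>G\<close> in the
    linearisation then stay within 2 L.\<close>
  obtain M where M: "M-lipschitz_on {-(2 * L)..2 * L} G"
    using C1_lipschitz_on_interval[OF assms(4)] .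
  have "0 < (2 - b) + real DIM(real ^ 'n)" using \<alpha> by (simp add: b_def)
  then obtain B where B: "0 \<le> B"
    "\<And>r. 0 < r \<Longrightarrow> set_integrable lborel (ball (0::real^'n) r) (\<lambda>y. norm y powr (2 - b))"
    "\<And>r. 0 < r \<Longrightarrow> (LINT y:ball (0::real^'n) r|lborel. norm y powr (2 - b))
        \<le> B * r powr ((2 - b) + real DIM(real ^ 'n))"
    by (rule norm_powr_integrable_ball) blast
  have B3: "(LINT y:ball (0::real^'n) r|lborel. norm y powr (2 - b)) \<le> B * r powr (2 - \<alpha>)"
    if "0 < r" for r
    using B(3)[OF that] by (simp add: b_def)

  \<comment> \<open>The negative contribution of a ball where u is positive\<close>
  define m where "m = u a / 2"
  have m: "0 < m" using u0[of a] a by (simp add: m_def)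
  have a0: "0 < norm a" using a uo by auto
  have "eventually (\<lambda>z. m < u z) (nhds a)"
    using cu m by (intro order_tendstoD[where y = "u a"])
      (auto simp: m_def continuous_on_eq_continuous_at isCont_def tendsto_at_iff_tendsto_nhds)
  then obtain s0 where s0: "0 < s0" "\<And>z. dist z a < s0 \<Longrightarrow> m < u z"
    by (auto simp: eventually_nhds_metric)
  \<comment> \<open>If \<open>r\<close>, \<open>s\<close> and |x| are at most |a|/4, points of the
    ball about \<open>a\<close> stay at distance between \<open>r\<close> and 2 |a| from x. Here |a|
    > 0 because u vanishes at the origin but not at \<open>a\<close>.\<close>
  define s where "s = min s0 (norm a / 4)"
  have s: "0 < s" "s \<le> norm a / 4" "\<And>z. z \<in> ball a s \<Longrightarrow> m \<le> u z"
    using s0 a0 by (auto simp: s_def dist_commute less_imp_le)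
  \<comment> \<open>The derivative bound gives G(-m/2) \<le> -c0 m/2; this is multiplied by the
    kernel at distance 2 |a| and by the volume of the ball.\<close>
  define \<delta> where "\<delta> = c0 * m / 2 * (2 * norm a) powr - b * measure lborel (ball (0::real^'n) s)"
  have \<delta>: "0 < \<delta>"
    using \<open>0 < c0\<close> m a0 content_ball_pos[OF s(1), of "0::real^'n"] by (simp add: \<delta>_def)

  \<comment> \<open>The quadratic error is made smaller than \<open>\<delta>\<close> at this stage;
    \<open>r\<close> then stays fixed while x approaches the origin.\<close>
  obtain r where r: "0 < r" "r \<le> 1" "r \<le> norm a / 4" "M * L * (B * r powr (2 - \<alpha>)) < \<delta>"
  proof -
    have "((\<lambda>r. M * L * (B * r powr (2 - \<alpha>))) \<longlongrightarrow> M * L * (B * 0)) (at_right 0)"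
      using \<alpha> by (intro tendsto_intros tendsto_zero_powrI[where b = "2 - \<alpha>"])
        (auto simp: eventually_at_right_less intro: eventually_mono[OF eventually_at_right_less])
    hence "eventually (\<lambda>r. M * L * (B * r powr (2 - \<alpha>)) < \<delta>) (at_right 0)"
      using \<delta> by (intro order_tendstoD) auto
    moreover have "eventually (\<lambda>r. r \<in> {0<..<min 1 (norm a / 4)}) (at_right 0)"
      using a0 by (intro eventually_at_right_real) auto
    ultimately have "eventually (\<lambda>r. 0 < r \<and> r \<le> 1 \<and> r \<le> norm a / 4
        \<and> M * L * (B * r powr (2 - \<alpha>)) < \<delta>) (at_right 0)"
      by eventually_elim auto
    from eventually_happens'[OF _ this] show ?thesis using that by auto
  qed
  define Q where "Q = (LINT y:- ball (0::real^'n) r|lborel. norm y powr - b)"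

  \<comment> \<open>Estimate of the equation near the origin\<close>
  define l where "l x = norm (Du x) / norm (Du x1)" for x
  \<comment> \<open>The three summands control the linear part, the quadratic error and the far
    part. As x tends to the origin, the first tends to 0 and the last to -\<delta>.\<close>
  have bound: "h (u x) / C \<le> l x powr \<alpha> * K + M * L * (B * r powr (2 - \<alpha>)) + (G (u x) * Q - \<delta>)"
    if x: "x \<in> half_space k" "norm x \<le> 1" "norm x \<le> norm a / 4" "u x \<le> m / 2" "l x * r \<le> \<eta>" for x
  proof -
    have near0: "norm (Du x) \<le> L"
    proof -
      have "norm (Du x) \<le> L * norm x"
        using lipschitz_onD[OF L, of x 0] x(2) Du_zero[OF uo] by (simp add: dist_norm)
      also have "\<dots> \<le> L" using x(2) L0 by (simp add: mult_left_le)
      finally show ?thesis .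
    qed
    have "cball x 1 \<subseteq> cball 0 2"
      using x(2) by (intro cball_subset_cball_iff[THEN iffD2]) (simp add: dist_norm)
    hence Lx: "L-lipschitz_on (cball x 1) Du"
      by (rule lipschitz_on_subset[OF L])
    have lin: "\<bar>linear_part b G (Du x) e r\<bar> \<le> l x powr \<alpha> * K" if e: "0 < e" "e < r" for e
    proof (cases "Du x = 0")
      \<comment> \<open>Both sides vanish: \<open>l x\<close> is 0 with
        \<open>0 powr \<alpha> = 0\<close>, and the integrand is built from
        \<open>G 0 = 0\<close>.\<close>
      case True
      thus ?thesis using \<open>G 0 = 0\<close> by (simp add: linear_part_def l_def set_lebesgue_integral_def)
    next
      case False
      hence l: "0 < l x" using x1 by (simp add: l_def)
      \<comment> \<open>After rescaling, the outer radius \<open>l x * r\<close> is at most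
        \<open>\<eta>\<close>, so the bound obtained at \<open>x1\<close> applies.\<close>
      have "\<bar>linear_part b G (Du x) e r\<bar> = l x powr \<alpha> * \<bar>linear_part b G (Du x1) (l x * e) (l x * r)\<bar>"
        unfolding b_def l_def by (subst linear_part_rescale[OF cG x1 False]) (simp add: abs_mult)
      also have "\<dots> \<le> l x powr \<alpha> * K"
        using K[of "l x * e" "l x * r"] l e x(5) by (intro mult_left_mono) auto
      finally show ?thesis .
    qed
    have far: "F_truncated \<alpha> G u x r \<le> G (u x) * Q - \<delta>"
    proof -
      have int: "set_integrable lborel {y. r \<le> norm y} (\<lambda>y. G (u x - u (x + y)) / norm y powr b)"
        using F(1)[OF x(1)] r(1) F_integrand_integrable_lborel[OF cu cG] by (simp add: F_defined_def b_def)
      have "r \<le> norm (z - x) \<and> norm (z - x) \<le> 2 * norm a" if "z \<in> ball a s" for z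
      proof -
        have "norm (z - a) < s" using that by (simp add: dist_norm norm_minus_commute)
        moreover have "norm a \<le> norm (a - z) + norm (z - x) + norm x"
          using norm_triangle_ineq[of "a - z" "z - x"] norm_triangle_ineq[of "a - x" x] by simp
        moreover have "norm (z - x) \<le> norm (z - a) + norm a + norm x"
          using norm_triangle_ineq[of "z - a" "a - x"] norm_triangle_ineq4[of a x] by simp
        ultimately show ?thesis using s(2) x(3) r(3) a0 by (simp add: norm_minus_commute)
      qed
      moreover have "G (- (m / 2)) \<le> - (c0 * m / 2)"
        using G_le[of "- (m / 2)" 0] m \<open>G 0 = 0\<close> by simp
      moreover have "real DIM(real ^ 'n) < b" using \<alpha> by (simp add: b_def)
      ultimately show ?thesis
        unfolding F_truncated_eq_lborel[OF cu cG] b_def[symmetric] Q_def \<delta>_def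
        using \<open>0 < c0\<close> m
        by (intro far_part_upper_bound[OF G_mono \<open>G 0 = 0\<close> u0 s(3) x(4) _ _ _ r(1) s(1) _ int]) auto
    qed
    have trunc: "F_truncated \<alpha> G u x e
        \<le> l x powr \<alpha> * K + M * L * (B * r powr (2 - \<alpha>)) + (G (u x) * Q - \<delta>)"
      if e: "0 < e" "e < r" for e
    proof -
      have "\<bar>(LINT y:annulus e r|lborel. G (u x - u (x + y)) / norm y powr b) - linear_part b G (Du x) e r\<bar>
          \<le> M * L * (B * r powr (2 - \<alpha>))"
        using near0
        by (intro near_part_linearisation[OF cu cG lipschitz_gradient_taylor[OF Du Lx] M _ L0 e(1) r(1,2)
            B(2)[OF r(1)] B3[OF r(1)]]) auto
      thus ?thesis
        using F_truncated_split[OF cu cG F(1)[OF x(1)] e] lin[OF e] far unfolding b_def by linarith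
    qed
    \<comment> \<open>The bound holds for all cutoffs below \<open>r\<close>, hence for the limit of
      the truncations, which is the value of \<open>Lim\<close> in \<open>F_op\<close>.\<close>
    obtain v where v: "(F_truncated \<alpha> G u x \<longlongrightarrow> v) (at_right 0)"
      using F(1)[OF x(1)] by (auto simp: F_defined_def)
    have "v \<le> l x powr \<alpha> * K + M * L * (B * r powr (2 - \<alpha>)) + (G (u x) * Q - \<delta>)"
      using eventually_at_right_real[OF r(1)]
      by (intro tendsto_upperbound[OF v]) (auto elim!: eventually_mono intro: trunc)
    moreover have "h (u x) = C * v"
      using F(2)[OF x(1)] tendsto_Lim[OF _ v] by (simp add: F_op_def)
    ultimately show ?thesis using \<open>0 < C\<close> by simp
  qed

  \<comment> \<open>Limit along the inner normal at the origin\<close>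
  define x where "x t = t *\<^sub>R axis k (1::real)" for t
  have x_tendsto: "(x \<longlongrightarrow> 0) (at_right 0)"
    unfolding x_def by (auto intro!: tendsto_eq_intros)
  have tu: "((\<lambda>t. u (x t)) \<longlongrightarrow> 0) (at_right 0)"
    using continuous_on_tendsto_compose[OF cu x_tendsto] uo by simp
  have tG: "((\<lambda>t. G (u (x t))) \<longlongrightarrow> 0) (at_right 0)"
    using continuous_on_tendsto_compose[OF cG tu] \<open>G 0 = 0\<close> by simp
  obtain Lh where Lh: "Lh-lipschitz_on (range u) h" using assms(14) by blast
  \<comment> \<open>Since 0 = u(0) belongs to the range of u, the Lipschitz condition makes
    \<open>h\<close> continuous at 0 along values of u.\<close>
  have "((\<lambda>t. h (u (x t))) \<longlongrightarrow> h 0) (at_right 0)"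
    using uo range_eqI[of 0 u 0]
    by (intro continuous_on_tendsto_compose[OF lipschitz_on_continuous_on[OF Lh] tu]) auto
  hence th: "((\<lambda>t. h (u (x t)) / C) \<longlongrightarrow> 0) (at_right 0)"
    using \<open>h 0 = 0\<close> \<open>0 < C\<close> by (auto intro!: tendsto_eq_intros)
  have "continuous_on (ball 0 1) Du"
    by (rule continuous_on_subset[OF lipschitz_on_continuous_on[OF L]]) auto
  hence "isCont Du 0" by (simp add: continuous_on_eq_continuous_at)
  hence "((\<lambda>t. Du (x t)) \<longlongrightarrow> Du 0) (at_right 0)"
    using x_tendsto by (rule isCont_tendsto_compose)
  hence tl: "((\<lambda>t. l (x t)) \<longlongrightarrow> 0) (at_right 0)"
    unfolding l_def using x1 Du_zero[OF uo] by (auto intro!: tendsto_eq_intros)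
  hence tl\<alpha>: "((\<lambda>t. l (x t) powr \<alpha>) \<longlongrightarrow> 0) (at_right 0)"
    using \<alpha> by (intro tendsto_zero_powrI[where b = \<alpha>]) (auto simp: l_def)
  have "((\<lambda>t. l (x t) * r) \<longlongrightarrow> 0) (at_right 0)"
    using tl by (auto intro!: tendsto_eq_intros)
  hence "eventually (\<lambda>t. l (x t) * r < \<eta>) (at_right 0)"
    using \<eta> by (rule order_tendstoD)
  moreover have "eventually (\<lambda>t. norm (x t) < min 1 (norm a / 4)) (at_right 0)"
    using a0 by (intro order_tendstoD(2)[OF tendsto_norm_zero[OF x_tendsto]]) simp
  moreover have "eventually (\<lambda>t. u (x t) < m / 2) (at_right 0)"
    using m by (intro order_tendstoD(2)[OF tu]) simp
  moreover have "eventually (\<lambda>t. x t \<in> half_space k) (at_right 0)"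
    using eventually_at_right_less[of "0::real"] by eventually_elim (simp add: x_def half_space_def)
  ultimately have ev: "eventually (\<lambda>t. h (u (x t)) / C
      \<le> l (x t) powr \<alpha> * K + M * L * (B * r powr (2 - \<alpha>)) + (G (u (x t)) * Q - \<delta>)) (at_right 0)"
    by eventually_elim (auto intro!: bound)
  \<comment> \<open>Only the quadratic error and -\<delta> survive in the limit. Their sum is
    negative by the choice of \<open>r\<close>, while the left side of the estimate tends to
    0.\<close>
  have "((\<lambda>t. l (x t) powr \<alpha> * K + M * L * (B * r powr (2 - \<alpha>)) + (G (u (x t)) * Q - \<delta>))
      \<longlongrightarrow> 0 * K + M * L * (B * r powr (2 - \<alpha>)) + (0 * Q - \<delta>)) (at_right 0)"
    by (intro tendsto_add tendsto_diff tendsto_mult_right tendsto_const tl\<alpha> tG)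
  from tendsto_le[OF _ this th ev] have "0 \<le> M * L * (B * r powr (2 - \<alpha>)) - \<delta>" by simp
  thus False using r(4) by simp
qed

end
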